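(* Let $(X,d)$ be a metric space and let $(f,g)$ be a commutative paired system on $X$ (i.e. $f,g:X\to X$ are uniform equivalences with $f\circ g=g\circ f$). Suppose that $g$ is equicontinuous. Then $(f,g)$ has the paired shadowing property if and only if $g^{-1}f=g^{-1}\circ f$ has the shadowing property.
   Context: A uniform equivalence of a metric space $(X,d)$ is a bijection $f:X\to X$ such that both $f$ and $f^{-1}$ are uniformly continuous. A paired system $(f,g)$ on $X$ is a pair of uniform equivalences $f,g:X\to X$; it is commutative if $f\circ g=g\circ f$. Paired shadowing property (PSP): a sequence $\{x_n\}_{n\in\mathbb{Z}}$ in $X$ is a $\delta$-pseudo orbit of $(f,g)$ if $d(f(x_n),g(x_{n+1}))\le\delta$ for each $n\in\mathbb{Z}$. It is $\epsilon$-traced (through $(f,g)$) by $x\in X$ if $d(f^n(x),g^n(x_n))\le\epsilon$ for each $n\in\mathbb{Z}$. The system $(f,g)$ has PSP if for each $\epsilon>0$ there exists $\delta>0$ such that each $\delta$-pseudo orbit of $(f,g)$ can be $\epsilon$-traced by some point of $X$. Shadowing property: a self-homeomorphism $h$ of $(X,d)$ has the shadowing property if for every $\epsilon>0$ there exists $\delta>0$ such that for every sequence $\{x_n\}_{n\in\mathbb{Z}}$ in $X$ with $d(h(x_n),x_{n+1})\le\delta$ for each $n\in\mathbb{Z}$, there exists $x\in X$ with $d(h^n(x),x_n)\le\epsilon$ for each $n\in\mathbb{Z}$. A homeomorphism $g$ of $X$ is equicontinuous if for each $\epsilon>0$ there exists $\delta>0$ such that $d(x,y)<\delta$ implies $d(g^n(x),g^n(y))<\epsilon$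 for each $n\in\mathbb{Z}$. *)

theory Defs
  imports Complex_Main
begin

(* The metric space X is a type of class metric_space. *)

definition uniform_equivalence :: "('a::metric_space \<Rightarrow> 'a) \<Rightarrow> bool" where
  "uniform_equivalence f \<longleftrightarrow>
     bij f \<and> uniformly_continuous_on UNIV f \<and> uniformly_continuous_on UNIV (inv f)"

definition paired_system :: "('a::metric_space \<Rightarrow> 'a) \<Rightarrow> ('a \<Rightarrow> 'a) \<Rightarrow> bool" where
  "paired_system f g \<longleftrightarrow> uniform_equivalence f \<and> uniform_equivalence g"

definition commutative_paired_system :: "('a::metric_space \<Rightarrow> 'a) \<Rightarrow> ('a \<Rightarrow> 'a) \<Rightarrow> bool" where
  "commutative_paired_system f g \<longleftrightarrow> paired_system f g \<and> f \<circ> g = g \<circ> f"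

(* The integer iterate f^n; meaningful for bijective f only, since inv f is
   otherwise not a two-sided inverse. *)
definition int_iterate :: "('a \<Rightarrow> 'a) \<Rightarrow> int \<Rightarrow> 'a \<Rightarrow> 'a" where
  "int_iterate f n = (if n \<ge> 0 then f ^^ nat n else (inv f) ^^ nat (- n))"

definition paired_pseudo_orbit ::
    "('a::metric_space \<Rightarrow> 'a) \<Rightarrow> ('a \<Rightarrow> 'a) \<Rightarrow> real \<Rightarrow> (int \<Rightarrow> 'a) \<Rightarrow> bool" where
  "paired_pseudo_orbit f g \<delta> x \<longleftrightarrow> (\<forall>n. dist (f (x n)) (g (x (n + 1))) \<le> \<delta>)"

definition paired_traced ::
    "('a::metric_space \<Rightarrow> 'a) \<Rightarrow> ('a \<Rightarrow> 'a) \<Rightarrow> real \<Rightarrow> (int \<Rightarrow> 'a) \<Rightarrow> 'a \<Rightarrow> bool" where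
  "paired_traced f g \<epsilon> x z \<longleftrightarrow>
     (\<forall>n. dist (int_iterate f n z) (int_iterate g n (x n)) \<le> \<epsilon>)"

definition paired_shadowing_property :: "('a::metric_space \<Rightarrow> 'a) \<Rightarrow> ('a \<Rightarrow> 'a) \<Rightarrow> bool" where
  "paired_shadowing_property f g \<longleftrightarrow>
     (\<forall>\<epsilon>>0. \<exists>\<delta>>0. \<forall>x. paired_pseudo_orbit f g \<delta> x \<longrightarrow> (\<exists>z. paired_traced f g \<epsilon> x z))"

definition shadowing_property :: "('a::metric_space \<Rightarrow> 'a) \<Rightarrow> bool" where
  "shadowing_property h \<longleftrightarrow>
     (\<forall>\<epsilon>>0. \<exists>\<delta>>0. \<forall>x :: int \<Rightarrow> 'a.
        (\<forall>n. dist (h (x n)) (x (n + 1)) \<le> \<delta>) \<longrightarrow>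
        (\<exists>z. \<forall>n. dist (int_iterate h n z) (x n) \<le> \<epsilon>))"

definition equicontinuous :: "('a::metric_space \<Rightarrow> 'a) \<Rightarrow> bool" where
  "equicontinuous g \<longleftrightarrow>
     (\<forall>\<epsilon>>0. \<exists>\<delta>>0. \<forall>x y. dist x y < \<delta> \<longrightarrow>
        (\<forall>n. dist (int_iterate g n x) (int_iterate g n y) < \<epsilon>))"

end

theory Submission
  imports Defs
begin

text \<open>
  Put \<open>h = g\<^sup>-\<^sup>1 \<circ> f\<close>. Both shadowing properties quantify over the same sequences \<open>x\<close> and the same
  tracing points \<open>z\<close>, and they differ only by an application of a power of \<open>g\<close>. For pseudo orbits,
  \<open>g\<close> maps the pair \<open>(h (x n), x (n + 1))\<close> to the pair \<open>(f (x n), g (x (n + 1)))\<close>, so uniform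
  continuity of \<open>g\<close> and of its inverse lets one pass between the two kinds of pseudo orbit, at the
  price of changing \<open>\<delta>\<close>. For tracing, commutativity gives \<open>g\<^sup>n \<circ> h\<^sup>n = f\<^sup>n\<close> for every integer \<open>n\<close>
  (lemma \<open>int_iterate_inv_comp\<close>), so \<open>g\<^sup>n\<close> maps the pair \<open>(h\<^sup>n z, x n)\<close> to \<open>(f\<^sup>n z, g\<^sup>n (x n))\<close>.
  Here the exponent is unbounded, and continuity of each separate power would not suffice: it is
  equicontinuity that makes the change of \<open>\<epsilon>\<close> uniform in \<open>n\<close>. As the condition ranges over all
  integers, it controls \<open>g\<^sup>-\<^sup>n\<close> as well, which gives the passage back.
\<close>

lemma funpow_comp_commute:
  assumes "f \<circ> g = g \<circ> f"
  shows "(f \<circ> g) ^^ n = (f ^^ n) \<circ> (g ^^ n)"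
proof (induction n)
  case (Suc n)
  have "g ((f ^^ n) y) = (f ^^ n) (g y)" for y
    using assms by (induction n) (simp, metis comp_apply funpow.simps(2))
  with Suc show ?case by (auto simp: fun_eq_iff)
qed simp

lemma inv_comp_commute:
  assumes "bij g" and "f \<circ> g = g \<circ> f"
  shows "f \<circ> inv g = inv g \<circ> f"
proof
  fix y
  have "g (f (inv g y)) = f y"
    using assms by (metis bij_inv_eq_iff comp_apply)
  then show "(f \<circ> inv g) y = (inv g \<circ> f) y"
    using assms(1) by (metis bij_inv_eq_iff comp_apply)
qed

lemma int_iterate_uminus_cancel:
  assumes "bij g"
  shows "int_iterate g (- n) (int_iterate g n y) = y"
    and "int_iterate g n (int_iterate g (- n) y) = y"
  using fn_o_inv_fn_is_id[OF assms] inv_fn_o_fn_is_id[OF assms]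
  by (auto simp: int_iterate_def fun_eq_iff)

text \<open>
  All four maps \<open>f\<close>, \<open>g\<close> and their inverses commute, so the powers of \<open>g\<^sup>-\<^sup>1 \<circ> f\<close> split into powers
  of the two factors, and \<open>g\<^sup>n\<close> cancels the first one. For negative \<open>n\<close> the factors are \<open>g\<close> and
  \<open>f\<^sup>-\<^sup>1\<close>, since \<open>(g\<^sup>-\<^sup>1 \<circ> f)\<^sup>-\<^sup>1 = f\<^sup>-\<^sup>1 \<circ> g\<close>.
\<close>
lemma int_iterate_inv_comp:
  assumes "bij f" "bij g" "f \<circ> g = g \<circ> f"
  shows "int_iterate g n (int_iterate (inv g \<circ> f) n z) = int_iterate f n z"
proof -
  have "inv (inv g \<circ> f) = inv f \<circ> g"
    using assms(1,2) by (simp add: o_inv_distrib bij_imp_bij_inv inv_inv_eq)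
  also have "\<dots> = g \<circ> inv f"
    using inv_comp_commute[OF assms(1)] assms(3) by metis
  finally have inv_h: "inv (inv g \<circ> f) = g \<circ> inv f" .
  have pos: "(inv g \<circ> f) ^^ k = (inv g ^^ k) \<circ> (f ^^ k)" for k
    using inv_comp_commute[OF assms(2,3)] by (intro funpow_comp_commute) simp
  have neg: "(g \<circ> inv f) ^^ k = (g ^^ k) \<circ> (inv f ^^ k)" for k
    using inv_comp_commute[OF assms(1)] assms(3) by (intro funpow_comp_commute) metis
  have "int_iterate (inv g \<circ> f) n z = int_iterate g (- n) (int_iterate f n z)"
    by (cases "n = 0") (auto simp: int_iterate_def inv_h pos neg)
  then show ?thesis
    by (simp add: int_iterate_uminus_cancel[OF assms(2)])
qed

lemma uniformly_continuous_on_UNIV_le: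
  fixes f :: "'a::metric_space \<Rightarrow> 'b::metric_space"
  assumes "uniformly_continuous_on UNIV f" and "\<epsilon> > 0"
  obtains \<delta> where "\<delta> > 0" "\<And>x y. dist x y \<le> \<delta> \<Longrightarrow> dist (f x) (f y) \<le> \<epsilon>"
proof -
  obtain d where d: "d > 0" "\<And>x y. dist x y < d \<Longrightarrow> dist (f x) (f y) < \<epsilon>"
    using assms unfolding uniformly_continuous_on_def by (metis UNIV_I)
  show ?thesis
    by (rule that[of "d / 2"]) (use d in \<open>auto intro!: less_imp_le[OF d(2)]\<close>)
qed

lemma equicontinuous_le:
  assumes "equicontinuous g" and "\<epsilon> > 0"
  obtains \<delta> where "\<delta> > 0"
    "\<And>x y n. dist x y \<le> \<delta> \<Longrightarrow> dist (int_iterate g n x) (int_iterate g n y) \<le> \<epsilon>"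
proof -
  obtain d where d: "d > 0"
    "\<And>x y n. dist x y < d \<Longrightarrow> dist (int_iterate g n x) (int_iterate g n y) < \<epsilon>"
    using assms unfolding equicontinuous_def by metis
  show ?thesis
    by (rule that[of "d / 2"]) (use d in \<open>auto intro!: less_imp_le[OF d(2)]\<close>)
qed

theorem theorem2p2:
  fixes f g :: "'a::metric_space \<Rightarrow> 'a"
  assumes "commutative_paired_system f g"
    and "equicontinuous g"
  shows "paired_shadowing_property f g \<longleftrightarrow> shadowing_property (inv g \<circ> f)"
proof -
  let ?h = "inv g \<circ> f"
  have bij: "bij f" "bij g" and comm: "f \<circ> g = g \<circ> f"
    and ucg: "uniformly_continuous_on UNIV g" "uniformly_continuous_on UNIV (inv g)"
    using assms(1)
    by (auto simp: commutative_paired_system_def paired_system_def uniform_equivalence_def)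
  have g_h: "g (?h y) = f y" and inv_g_g: "inv g (g y) = y" for y
    using bij(2) by (simp_all add: bij_is_surj surj_f_inv_f bij_is_inj)
  note g_h_pow = int_iterate_inv_comp[OF bij comm]
  have h_pow: "int_iterate g (- n) (int_iterate f n z) = int_iterate ?h n z" for n z
    by (metis g_h_pow int_iterate_uminus_cancel(1)[OF bij(2)])
  show ?thesis
  proof
    assume psp: "paired_shadowing_property f g"
    show "shadowing_property ?h"
      unfolding shadowing_property_def
    proof (intro allI impI)
      fix \<epsilon> :: real assume "\<epsilon> > 0"
      then obtain \<epsilon>' where \<epsilon>': "\<epsilon>' > 0"
        "\<And>x y n. dist x y \<le> \<epsilon>' \<Longrightarrow> dist (int_iterate g n x) (int_iterate g n y) \<le> \<epsilon>"
        using equicontinuous_le[OF assms(2)] by metis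
      obtain \<delta>' where \<delta>': "\<delta>' > 0"
        "\<And>x. paired_pseudo_orbit f g \<delta>' x \<Longrightarrow> \<exists>z. paired_traced f g \<epsilon>' x z"
        using psp \<epsilon>'(1) unfolding paired_shadowing_property_def by metis
      obtain \<delta> where \<delta>: "\<delta> > 0" "\<And>x y. dist x y \<le> \<delta> \<Longrightarrow> dist (g x) (g y) \<le> \<delta>'"
        using uniformly_continuous_on_UNIV_le[OF ucg(1) \<delta>'(1)] by metis
      have "\<exists>z. \<forall>n. dist (int_iterate ?h n z) (x n) \<le> \<epsilon>"
        if x: "\<forall>n. dist (?h (x n)) (x (n + 1)) \<le> \<delta>" for x
      proof -
        have "paired_pseudo_orbit f g \<delta>' x"
          unfolding paired_pseudo_orbit_def using \<delta>(2) x g_h by metis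
        then obtain z where z: "paired_traced f g \<epsilon>' x z"
          using \<delta>'(2) by blast
        have "dist (int_iterate ?h n z) (x n) \<le> \<epsilon>" for n
          using \<epsilon>'(2)[of "int_iterate f n z" "int_iterate g n (x n)" "- n"] z
          unfolding paired_traced_def h_pow int_iterate_uminus_cancel(1)[OF bij(2)] by blast
        then show ?thesis by blast
      qed
      with \<delta>(1) show "\<exists>\<delta>>0. \<forall>x. (\<forall>n. dist (?h (x n)) (x (n + 1)) \<le> \<delta>) \<longrightarrow>
          (\<exists>z. \<forall>n. dist (int_iterate ?h n z) (x n) \<le> \<epsilon>)"
        by blast
    qed
  next
    assume sp: "shadowing_property ?h"
    show "paired_shadowing_property f g"
      unfolding paired_shadowing_property_def
    proof (intro allI impI)
      fix \<epsilon> :: real assume "\<epsilon> > 0"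
      then obtain \<epsilon>' where \<epsilon>': "\<epsilon>' > 0"
        "\<And>x y n. dist x y \<le> \<epsilon>' \<Longrightarrow> dist (int_iterate g n x) (int_iterate g n y) \<le> \<epsilon>"
        using equicontinuous_le[OF assms(2)] by metis
      obtain \<delta>' where \<delta>': "\<delta>' > 0"
        "\<And>x. \<forall>n. dist (?h (x n)) (x (n + 1)) \<le> \<delta>' \<Longrightarrow>
          \<exists>z. \<forall>n. dist (int_iterate ?h n z) (x n) \<le> \<epsilon>'"
        using sp \<epsilon>'(1) unfolding shadowing_property_def by metis
      obtain \<delta> where \<delta>: "\<delta> > 0" "\<And>x y. dist x y \<le> \<delta> \<Longrightarrow> dist (inv g x) (inv g y) \<le> \<delta>'"
        using uniformly_continuous_on_UNIV_le[OF ucg(2) \<delta>'(1)] by metis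
      have "\<exists>z. paired_traced f g \<epsilon> x z" if x: "paired_pseudo_orbit f g \<delta> x" for x
      proof -
        have "\<forall>n. dist (?h (x n)) (x (n + 1)) \<le> \<delta>'"
          using \<delta>(2) x inv_g_g unfolding paired_pseudo_orbit_def comp_apply by metis
        then obtain z where z: "\<And>n. dist (int_iterate ?h n z) (x n) \<le> \<epsilon>'"
          using \<delta>'(2) by blast
        have "paired_traced f g \<epsilon> x z"
          unfolding paired_traced_def using \<epsilon>'(2)[OF z] g_h_pow by metis
        then show ?thesis by blast
      qed
      with \<delta>(1) show "\<exists>\<delta>>0. \<forall>x. paired_pseudo_orbit f g \<delta> x \<longrightarrow>
          (\<exists>z. paired_traced f g \<epsilon> x z)"
        by blast
    qed
  qed
qed

end
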